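(* Let $D$ be a unicyclic bipartite graph with a unique perfect matching and exactly two pegs $\rho_1$ and $\rho_2$. Then for any two vertices $u,v$ of $D$, if there are two co-augmenting paths from $u$ to $v$, then $\rho_1$ and $\rho_2$ are edges of both of these paths.
   Context: A unicyclic graph is a connected graph containing exactly one cycle. Let $\mathcal{M}$ be the unique perfect matching. A peg is an edge of $\mathcal{M}$ that is not an edge of the cycle but is incident to a vertex of the cycle. A path is co-augmenting if its edges alternate between edges of $\mathcal{M}$ and edges not in $\mathcal{M}$, with the first and last edges in $\mathcal{M}$. *)

theory Defs
  imports Main
begin

definition simple_graph :: "'a set \<Rightarrow> 'a set set \<Rightarrow> bool" where
  "simple_graph V E \<longleftrightarrow> finite V \<and> (\<forall>e\<in>E. \<exists>x\<in>V. \<exists>y\<in>V. x \<noteq> y \<and> e = {x, y})"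

text \<open>Paths are represented by their lists of vertices.\<close>

fun edge_list :: "'a list \<Rightarrow> 'a set list" where
  "edge_list [] = []"
| "edge_list [x] = []"
| "edge_list (x # y # zs) = {x, y} # edge_list (y # zs)"

definition is_path :: "'a set \<Rightarrow> 'a set set \<Rightarrow> 'a \<Rightarrow> 'a list \<Rightarrow> 'a \<Rightarrow> bool" where
  "is_path V E u p v \<longleftrightarrow>
     p \<noteq> [] \<and> hd p = u \<and> last p = v \<and> distinct p \<and> set p \<subseteq> V \<and> set (edge_list p) \<subseteq> E"

definition connected_graph :: "'a set \<Rightarrow> 'a set set \<Rightarrow> bool" where
  "connected_graph V E \<longleftrightarrow> V \<noteq> {} \<and> (\<forall>u\<in>V. \<forall>v\<in>V. \<exists>p. is_path V E u p v)"

text \<open>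
  A cycle is identified with its set of edges, so that its rotations and its reversal, which are
  different vertex lists, count as the same cycle. Its vertices are the elements of \<open>\<Union>C\<close>.
\<close>

definition is_cycle :: "'a set \<Rightarrow> 'a set set \<Rightarrow> 'a set set \<Rightarrow> bool" where
  "is_cycle V E C \<longleftrightarrow>
     (\<exists>p. length p \<ge> 3 \<and> distinct p \<and> set p \<subseteq> V \<and>
          C = set (edge_list (p @ [hd p])) \<and> C \<subseteq> E)"

definition unicyclic :: "'a set \<Rightarrow> 'a set set \<Rightarrow> bool" where
  "unicyclic V E \<longleftrightarrow> connected_graph V E \<and> (\<exists>!C. is_cycle V E C)"

definition bipartite :: "'a set \<Rightarrow> 'a set set \<Rightarrow> bool" where
  "bipartite V E \<longleftrightarrow>
     (\<exists>X Y. X \<union> Y = V \<and> X \<inter> Y = {} \<and> (\<forall>e\<in>E. \<exists>x\<in>X. \<exists>y\<in>Y. e = {x, y}))"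

definition perfect_matching :: "'a set \<Rightarrow> 'a set set \<Rightarrow> 'a set set \<Rightarrow> bool" where
  "perfect_matching V E M \<longleftrightarrow> M \<subseteq> E \<and> (\<forall>v\<in>V. \<exists>!e. e \<in> M \<and> v \<in> e)"

definition unique_perfect_matching :: "'a set \<Rightarrow> 'a set set \<Rightarrow> 'a set set \<Rightarrow> bool" where
  "unique_perfect_matching V E M \<longleftrightarrow>
     perfect_matching V E M \<and> (\<forall>M'. perfect_matching V E M' \<longrightarrow> M' = M)"

definition pegs :: "'a set set \<Rightarrow> 'a set set \<Rightarrow> 'a set set" where
  "pegs M C = {e \<in> M. e \<notin> C \<and> e \<inter> \<Union>C \<noteq> {}}"

text \<open>A path without edges has no first or last edge, so it is not co-augmenting.\<close>

definition co_augmenting_path ::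
    "'a set \<Rightarrow> 'a set set \<Rightarrow> 'a set set \<Rightarrow> 'a \<Rightarrow> 'a list \<Rightarrow> 'a \<Rightarrow> bool" where
  "co_augmenting_path V E M u p v \<longleftrightarrow>
     is_path V E u p v \<and> edge_list p \<noteq> [] \<and>
     hd (edge_list p) \<in> M \<and> last (edge_list p) \<in> M \<and>
     (\<forall>i. Suc i < length (edge_list p) \<longrightarrow>
        (edge_list p ! i \<in> M \<longleftrightarrow> edge_list p ! Suc i \<notin> M))"

end

theory Submission
  imports Defs
begin

text \<open>
  Two distinct paths from \<open>u\<close> to \<open>v\<close> separate at a vertex \<open>a\<close> and meet again at a
  vertex \<open>b\<close>, and the two segments between \<open>a\<close> and \<open>b\<close> form the unique cycle.
  Only one edge of the matching is incident to \<open>a\<close>, so the edges with which the paths leave \<open>a\<close>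
  are not in the matching, and the common edge with which they reach \<open>a\<close> is. Bipartiteness makes
  the two segments have the same parity, so the same argument applies at \<open>b\<close>: the paths
  leave \<open>b\<close> through a common edge of the matching. These two matching edges are disjoint pegs,
  hence they are all the pegs.
\<close>

lemma length_edge_list: "length (edge_list xs) = length xs - 1"
  by (induction xs rule: edge_list.induct) auto

lemma edge_list_append: "edge_list (xs @ x # ys) = edge_list (xs @ [x]) @ edge_list (x # ys)"
  by (induction xs rule: edge_list.induct) auto

lemma edge_list_snoc2: "edge_list (xs @ [x, y]) = edge_list (xs @ [x]) @ [{x, y}]"
  using edge_list_append[of xs x "[y]"] by simp

lemma set_edge_list_rev: "set (edge_list (rev xs)) = set (edge_list xs)"
  by (induction xs rule: edge_list.induct) (auto simp: edge_list_snoc2 insert_commute)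

lemma nth_edge_list: "edge_list (xs @ x # y # ys) ! length xs = {x, y}"
  using edge_list_append[of xs x "y # ys"] by (simp add: nth_append length_edge_list)

lemma edge_in_edge_list: "{x, y} \<in> set (edge_list (xs @ x # y # ys))"
  using edge_list_append[of xs x "y # ys"] by simp

lemma Union_edge_list: "length xs \<ge> 2 \<Longrightarrow> \<Union> (set (edge_list xs)) = set xs"
proof (induction xs rule: edge_list.induct)
  case (3 x y zs)
  then show ?case by (cases zs) auto
qed auto

text \<open>The vertex \<open>b\<close> is the first one after \<open>a\<close> on \<open>p\<close>
  that also lies on the rest of \<open>q\<close>. Hence \<open>p\<^sub>1\<close> avoids everything
  after \<open>a\<close> on \<open>q\<close>, while \<open>p\<^sub>2\<close> may still meet
  \<open>q\<^sub>1\<close>. Writing \<open>p\<^sub>1 @ [b]\<close> in the condition on heads covers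
  an empty segment, where the vertex after \<open>a\<close> is \<open>b\<close> itself.\<close>

lemma path_decomposition:
  assumes "p \<noteq> q" "p \<noteq> []" "q \<noteq> []" "hd p = hd q" "last p = last q" "distinct p" "distinct q"
  obtains s a p\<^sub>1 q\<^sub>1 b p\<^sub>2 q\<^sub>2 where
    "p = s @ a # p\<^sub>1 @ b # p\<^sub>2" "q = s @ a # q\<^sub>1 @ b # q\<^sub>2"
    "hd (p\<^sub>1 @ [b]) \<noteq> hd (q\<^sub>1 @ [b])" "set p\<^sub>1 \<inter> set (q\<^sub>1 @ b # q\<^sub>2) = {}"
proof -
  have "\<exists>s a x p' y q'. p = s @ a # x # p' \<and> q = s @ a # y # q' \<and> x \<noteq> y"
    using assms
  proof (induction p arbitrary: q)
    case (Cons a p)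
    then obtain q' where q: "q = a # q'" by (cases q) auto
    with Cons.prems have "p \<noteq> q'" by simp
    have "p \<noteq> []" "q' \<noteq> []"
      using Cons.prems q by (auto split: if_splits)
    then obtain x p'' y q'' where xy: "p = x # p''" "q' = y # q''"
      by (meson neq_Nil_conv)
    show ?case
    proof (cases "x = y")
      case True
      with Cons.prems q xy have "\<exists>s a x p'' y q''. p = s @ a # x # p'' \<and> q' = s @ a # y # q'' \<and> x \<noteq> y"
        by (intro Cons.IH) auto
      then show ?thesis using q by (metis append_Cons)
    next
      case False
      then show ?thesis using q xy by (metis append_Nil)
    qed
  qed simp
  then obtain s a x p' y q' where sp: "p = s @ a # x # p'" "q = s @ a # y # q'" "x \<noteq> y" by blast
  then have "last (x # p') = last (y # q')" using assms(5) by simp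
  \<comment> \<open>The common last vertex guarantees that the paths meet again after
    \<open>a\<close>.\<close>
  then have "\<exists>z\<in>set (x # p'). z \<in> set (y # q')" by (metis last_in_set list.distinct(1))
  from split_list_first_prop[OF this]
  obtain p1 b p2 where 1: "x # p' = p1 @ b # p2" "b \<in> set (y # q')" "\<forall>z\<in>set p1. z \<notin> set (y # q')"
    by blast
  obtain q1 q2 where 2: "y # q' = q1 @ b # q2" using 1(2) by (meson split_list)
  have "hd (p1 @ [b]) = x" "hd (q1 @ [b]) = y"
    using arg_cong[OF 1(1), of hd] arg_cong[OF 2, of hd] by (auto simp: hd_append split: if_splits)
  then show thesis
    using that[of s a p1 b p2 q1 q2] sp 1 2 by auto
qed

text \<open>The edge at position 0 is in \<open>M\<close>, so alternation puts exactly the edges at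
  even positions in \<open>M\<close>; \<open>length xs\<close> is the position of
  \<open>{x, y}\<close>.\<close>

lemma co_augmenting_edge_parity:
  assumes "co_augmenting_path V E M u (xs @ x # y # ys) v"
  shows "{x, y} \<in> M \<longleftrightarrow> even (length xs)"
proof -
  let ?es = "edge_list (xs @ x # y # ys)"
  have "?es ! n \<in> M \<longleftrightarrow> even n" if "n < length ?es" for n
    using that
  proof (induction n)
    case 0
    then show ?case using assms unfolding co_augmenting_path_def by (metis even_zero hd_conv_nth)
  next
    case (Suc n)
    then have "?es ! n \<in> M \<longleftrightarrow> ?es ! Suc n \<notin> M"
      using assms unfolding co_augmenting_path_def by blast
    with Suc.IH Suc.prems show ?case by (metis Suc_lessD even_Suc)
  qed
  from this[of "length xs"] show ?thesis
    by (simp add: nth_edge_list length_edge_list)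
qed

text \<open>Every edge changes sides, and \<open>length xs\<close> edges lead from the first vertex
  to \<open>x\<close>.\<close>

lemma bipartite_path_parity:
  assumes "X \<inter> Y = {}" "\<forall>e\<in>E. \<exists>x\<in>X. \<exists>y\<in>Y. e = {x, y}"
    and "set (edge_list (xs @ x # ys)) \<subseteq> E"
  shows "x \<in> X \<longleftrightarrow> (hd (xs @ [x]) \<in> X \<longleftrightarrow> even (length xs))"
  using assms(3)
proof (induction xs)
  case (Cons z zs)
  have "{z, hd (zs @ [x])} \<in> E"
    using Cons.prems by (cases zs) auto
  then have "z \<in> X \<longleftrightarrow> hd (zs @ [x]) \<notin> X"
    using assms(1,2) by (fastforce simp: doubleton_eq_iff)
  moreover have "set (edge_list (zs @ x # ys)) \<subseteq> E"
    using Cons.prems by (cases zs) auto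
  ultimately show ?case using Cons.IH by auto
qed simp

lemma perfect_matching_edge_unique:
  assumes "perfect_matching V E M" "x \<in> V" "{x, y} \<in> M" "{x, z} \<in> M"
  shows "y = z"
proof -
  have "{x, y} = {x, z}"
    using assms unfolding perfect_matching_def by blast
  then show ?thesis by (auto simp: doubleton_eq_iff)
qed

text \<open>The cycle runs from \<open>a\<close> to \<open>b\<close> through
  \<open>p\<^sub>1\<close> and back through \<open>q\<^sub>1\<close> reversed. A nonempty segment
  supplies the third vertex.\<close>

lemma is_cycle_two_segments:
  assumes p: "is_path V E u (s @ a # p\<^sub>1 @ b # p\<^sub>2) v"
    and q: "is_path V E u (s @ a # q\<^sub>1 @ b # q\<^sub>2) v"
    and disj: "set p\<^sub>1 \<inter> set q\<^sub>1 = {}" and ne: "p\<^sub>1 \<noteq> [] \<or> q\<^sub>1 \<noteq> []"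
  shows "is_cycle V E (set (edge_list (a # p\<^sub>1 @ b # rev q\<^sub>1 @ [a])))"
proof -
  let ?c = "a # p\<^sub>1 @ b # rev q\<^sub>1"
  have "set (edge_list (a # p\<^sub>1 @ [b])) \<subseteq> E"
    using p edge_list_append[of s a "p\<^sub>1 @ b # p\<^sub>2"] edge_list_append[of "a # p\<^sub>1" b p\<^sub>2]
    unfolding is_path_def by auto
  moreover have "set (edge_list (a # q\<^sub>1 @ [b])) \<subseteq> E"
    using q edge_list_append[of s a "q\<^sub>1 @ b # q\<^sub>2"] edge_list_append[of "a # q\<^sub>1" b q\<^sub>2]
    unfolding is_path_def by auto
  then have "set (edge_list (b # rev q\<^sub>1 @ [a])) \<subseteq> E"
    using set_edge_list_rev[of "a # q\<^sub>1 @ [b]"] by simp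
  ultimately have "set (edge_list (?c @ [hd ?c])) \<subseteq> E"
    using edge_list_append[of "a # p\<^sub>1" b "rev q\<^sub>1 @ [a]"] by simp
  moreover have "length ?c \<ge> 3" using ne by (cases p\<^sub>1; cases q\<^sub>1) auto
  moreover have "distinct ?c" "set ?c \<subseteq> V" using p q disj unfolding is_path_def by auto
  ultimately show ?thesis unfolding is_cycle_def by (intro exI[of _ ?c]) auto
qed

theorem theorem11:
  fixes V :: "'a set" and E M C :: "'a set set" and \<rho>\<^sub>1 \<rho>\<^sub>2 :: "'a set"
    and u v :: 'a and p q :: "'a list"
  assumes "simple_graph V E"
    and "unicyclic V E"
    and "bipartite V E"
    and "unique_perfect_matching V E M"
    and "is_cycle V E C"
    and "pegs M C = {\<rho>\<^sub>1, \<rho>\<^sub>2}" and "\<rho>\<^sub>1 \<noteq> \<rho>\<^sub>2"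
    and "u \<in> V" and "v \<in> V"
    and "co_augmenting_path V E M u p v"
    and "co_augmenting_path V E M u q v"
    and "p \<noteq> q"
  shows "\<rho>\<^sub>1 \<in> set (edge_list p) \<and> \<rho>\<^sub>2 \<in> set (edge_list p) \<and>
         \<rho>\<^sub>1 \<in> set (edge_list q) \<and> \<rho>\<^sub>2 \<in> set (edge_list q)"
proof -
  have p: "is_path V E u p v" and q: "is_path V E u q v"
    using assms(10,11) unfolding co_augmenting_path_def by auto
  have pm: "perfect_matching V E M"
    using assms(4) unfolding unique_perfect_matching_def by simp
  have "p \<noteq> []" "q \<noteq> []" "hd p = hd q" "last p = last q" and dist: "distinct p" "distinct q"
    using p q unfolding is_path_def by auto
  then obtain s a p1 q1 b p2 q2 where
    pe: "p = s @ a # p1 @ b # p2" and qe: "q = s @ a # q1 @ b # q2" and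
    hds: "hd (p1 @ [b]) \<noteq> hd (q1 @ [b])" and disj: "set p1 \<inter> set (q1 @ b # q2) = {}"
    using path_decomposition[OF assms(12)] by metis
  have ne: "p1 \<noteq> [] \<or> q1 \<noteq> []" using hds by auto
  have abV: "a \<in> V" "b \<in> V" using p pe unfolding is_path_def by auto

  define c where "c = a # p1 @ b # rev q1 @ [a]"
  have "is_cycle V E (set (edge_list c))"
    unfolding c_def using p q disj ne unfolding pe qe
    by (intro is_cycle_two_segments) auto
  then have C: "C = set (edge_list c)"
    using assms(2,5) unfolding unicyclic_def by blast
  have UC: "\<Union>C = insert a (insert b (set p1 \<union> set q1))"
    unfolding C using Union_edge_list[of c] by (auto simp: c_def)
  then have abC: "a \<in> \<Union>C" "b \<in> \<Union>C" by blast+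
  \<comment> \<open>An edge with an end off the cycle cannot belong to \<open>C\<close>.\<close>
  have pegI: "{x, y} \<in> {\<rho>\<^sub>1, \<rho>\<^sub>2}" if "{x, y} \<in> M" "x \<in> \<Union>C" "y \<notin> \<Union>C" for x y
  proof -
    have "{x, y} \<notin> C" "{x, y} \<inter> \<Union>C \<noteq> {}" using that by auto
    then have "{x, y} \<in> pegs M C" using that(1) unfolding pegs_def by simp
    then show ?thesis unfolding assms(6) .
  qed

  obtain w pt where w: "p1 @ b # p2 = w # pt" "w = hd (p1 @ [b])" by (cases p1) auto
  obtain w' qt where w': "q1 @ b # q2 = w' # qt" "w' = hd (q1 @ [b])" by (cases q1) auto
  have "{a, w} \<in> M \<longleftrightarrow> even (length s)" "{a, w'} \<in> M \<longleftrightarrow> even (length s)"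
    using co_augmenting_edge_parity[of V E M u s a] assms(10,11) unfolding pe qe w(1) w'(1) by auto
  moreover have "\<not> ({a, w} \<in> M \<and> {a, w'} \<in> M)"
    using perfect_matching_edge_unique[OF pm abV(1)] hds w(2) w'(2) by blast
  \<comment> \<open>An even length would put both edges leaving \<open>a\<close> in
    \<open>M\<close>. Being odd, \<open>s\<close> is also nonempty, so a vertex \<open>d\<close>
    precedes \<open>a\<close>.\<close>
  ultimately have odd_s: "odd (length s)" by blast
  then obtain r d where s: "s = r @ [d]" by (cases s rule: rev_cases) auto
  have "{d, a} \<in> M"
    using co_augmenting_edge_parity[of V E M u r d a] assms(10) odd_s unfolding pe s by simp
  moreover have "d \<notin> \<Union>C" using dist UC unfolding pe qe s by auto
  ultimately have e: "{d, a} \<in> {\<rho>\<^sub>1, \<rho>\<^sub>2}"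
    using pegI[of a d] abC by (metis insert_commute)

  \<comment> \<open>The vertices \<open>z\<close> and \<open>z'\<close> precede \<open>b\<close> on
    the two paths; either one is \<open>a\<close> if its segment is empty.\<close>
  obtain ps z where z: "a # p1 = ps @ [z]" by (cases "a # p1" rule: rev_cases) auto
  obtain qs z' where z': "a # q1 = qs @ [z']" by (cases "a # q1" rule: rev_cases) auto
  have pz: "p = (s @ ps) @ z # b # p2" and qz: "q = (s @ qs) @ z' # b # q2"
    using arg_cong[OF z, of "\<lambda>xs. s @ xs @ b # p2"] arg_cong[OF z', of "\<lambda>xs. s @ xs @ b # q2"]
    by (auto simp: pe qe)
  \<comment> \<open>Two nonempty segments end differently because they are disjoint. If just one is
    empty, \<open>a\<close> would have to lie in the other, against distinctness.\<close>
  have "z \<noteq> z'"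
  proof
    assume "z = z'"
    moreover have "z = last (a # p1)" "z' = last (a # q1)" using z z' by simp_all
    ultimately have "last (a # p1) = last (a # q1)" by simp
    moreover have "a \<notin> set p1" "a \<notin> set q1" using dist pe qe by auto
    moreover have "last p1 \<noteq> last q1" if "p1 \<noteq> []" "q1 \<noteq> []"
      using disj last_in_set[OF that(1)] last_in_set[OF that(2)] by auto
    ultimately show False using ne last_in_set[of p1] last_in_set[of q1] by (auto split: if_splits)
  qed
  then have "\<not> ({z, b} \<in> M \<and> {z', b} \<in> M)"
    using perfect_matching_edge_unique[OF pm abV(2), of z z'] by (auto simp: insert_commute)
  moreover note pM = co_augmenting_edge_parity[OF assms(10)[unfolded pz]]
    and qM = co_augmenting_edge_parity[OF assms(11)[unfolded qz]]
  \<comment> \<open>On both paths the parity of the position of \<open>b\<close> is fixed by whether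
    \<open>u\<close> and \<open>b\<close> lie on the same side.\<close>
  moreover have "even (length (s @ ps)) \<longleftrightarrow> even (length (s @ qs))"
  proof -
    obtain X Y where XY: "X \<inter> Y = {}" "\<forall>e\<in>E. \<exists>x\<in>X. \<exists>y\<in>Y. e = {x, y}"
      using assms(3) unfolding bipartite_def by blast
    have "b \<in> X \<longleftrightarrow> (u \<in> X \<longleftrightarrow> even (length (s @ ps @ [z])))"
      using bipartite_path_parity[OF XY, of "s @ ps @ [z]" b p2] p
      unfolding is_path_def pz by (auto simp: hd_append split: if_splits)
    moreover have "b \<in> X \<longleftrightarrow> (u \<in> X \<longleftrightarrow> even (length (s @ qs @ [z'])))"
      using bipartite_path_parity[OF XY, of "s @ qs @ [z']" b q2] q
      unfolding is_path_def qz by (auto simp: hd_append split: if_splits)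
    ultimately show ?thesis by auto
  qed
  ultimately have odd: "odd (length (s @ ps))" "odd (length (s @ qs))" by blast+

  \<comment> \<open>A path ending at \<open>b\<close> would have \<open>{z, b}\<close>, which is not
    in \<open>M\<close>, as its last edge.\<close>
  have "p2 \<noteq> []"
  proof
    assume "p2 = []"
    then have "last (edge_list p) = {z, b}" unfolding pz by (simp add: edge_list_snoc2 flip: append_assoc)
    then show False using assms(10) pM odd unfolding co_augmenting_path_def by simp
  qed
  moreover have "q2 \<noteq> []"
  proof
    assume "q2 = []"
    then have "last (edge_list q) = {z', b}" unfolding qz by (simp add: edge_list_snoc2 flip: append_assoc)
    then show False using assms(11) qM odd unfolding co_augmenting_path_def by simp
  qed
  ultimately obtain x p3 y q3 where p2: "p2 = x # p3" and q2: "q2 = y # q3"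
    by (meson neq_Nil_conv)
  have bx: "{b, x} \<in> M" and "{b, y} \<in> M"
    using co_augmenting_edge_parity[of V E M u "s @ ps @ [z]" b]
      co_augmenting_edge_parity[of V E M u "s @ qs @ [z']" b] assms(10,11) odd
    unfolding pz qz p2 q2 by auto
  then have xy: "x = y" using perfect_matching_edge_unique[OF pm abV(2)] by blast
  \<comment> \<open>Since \<open>x = y\<close> comes after \<open>b\<close> on both paths,
    distinctness of \<open>p\<close> keeps it out of \<open>p1\<close>, and distinctness of
    \<open>q\<close> keeps it out of \<open>q1\<close>.\<close>
  have "x \<notin> \<Union>C" using dist UC unfolding pe qe p2 q2 xy by auto
  then have f: "{b, x} \<in> {\<rho>\<^sub>1, \<rho>\<^sub>2}" using pegI[OF bx] abC by blast

  \<comment> \<open>Two different members of \<open>{\<rho>\<^sub>1, \<rho>\<^sub>2}\<close> exhaust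
    that set, so each peg is one of these two edges.\<close>
  have "{d, a} \<noteq> {b, x}" using dist unfolding pe s by (auto simp: doubleton_eq_iff)
  then have "\<rho>\<^sub>1 \<in> {{d, a}, {b, x}}" "\<rho>\<^sub>2 \<in> {{d, a}, {b, x}}"
    using e f unfolding insert_iff empty_iff by metis+
  moreover have "{d, a} \<in> set (edge_list p)" "{d, a} \<in> set (edge_list q)"
    using edge_in_edge_list[of d a r] by (simp_all add: pe qe s)
  moreover have "{b, x} \<in> set (edge_list p)" "{b, x} \<in> set (edge_list q)"
    using edge_in_edge_list[of b x "s @ a # p1" p3] edge_in_edge_list[of b x "s @ a # q1" q3]
    by (simp_all add: pe qe p2 q2 xy)
  ultimately show ?thesis unfolding insert_iff empty_iff by metis
qed

end
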